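(* Let $n>1$ be an integer and $R=\mathbb{Z}_{2^n}[i]$. The clique number of the zero-divisor graph $\Gamma(R)$ is equal to the number of nilpotent elements of index $2$ in $R$.
   Context: $\mathbb{Z}_{2^n}[i]=\{a+ib: a,b\in\mathbb{Z}_{2^n}\}\cong \mathbb{Z}[i]/\langle 2^n\rangle$ is the ring of Gaussian integers modulo $2^n$. For a commutative ring $R$, the zero-divisor graph $\Gamma(R)$ is the simple graph whose vertex set is the set $\mathcal{Z}(R)$ of nonzero zero-divisors of $R$, two distinct vertices $x,y$ being adjacent if and only if $xy=0$. The clique number is the largest order of a complete subgraph. An element $x$ is nilpotent of index $2$ if $x\neq 0$ and $x^2=0$. *)

theory Defs
  imports "HOL-Number_Theory.Residues" "HOL-Library.Ramsey"
begin

text \<open>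
  For a commutative ring \<open>A\<close>, the ring \<open>A[i]\<close> of formal sums \<open>a + ib\<close> with \<open>i\<^sup>2 = -1\<close>; the pair
  \<open>(a, b)\<close> stands for \<open>a + ib\<close>.
\<close>

definition adjoin_i :: "('a, 'm) ring_scheme \<Rightarrow> ('a \<times> 'a) ring"
  where "adjoin_i A =
    \<lparr>carrier = carrier A \<times> carrier A,
     monoid.mult = \<lambda>(a, b) (c, d).
       ((a \<otimes>\<^bsub>A\<^esub> c) \<ominus>\<^bsub>A\<^esub> (b \<otimes>\<^bsub>A\<^esub> d), (a \<otimes>\<^bsub>A\<^esub> d) \<oplus>\<^bsub>A\<^esub> (b \<otimes>\<^bsub>A\<^esub> c)),
     one = (\<one>\<^bsub>A\<^esub>, \<zero>\<^bsub>A\<^esub>),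
     zero = (\<zero>\<^bsub>A\<^esub>, \<zero>\<^bsub>A\<^esub>),
     add = \<lambda>(a, b) (c, d). (a \<oplus>\<^bsub>A\<^esub> c, b \<oplus>\<^bsub>A\<^esub> d)\<rparr>"

definition gauss_residue_ring :: "int \<Rightarrow> (int \<times> int) ring"
  where "gauss_residue_ring m = adjoin_i (residue_ring m)"

lemma cring_adjoin_i:
  assumes "cring A"
  shows "cring (adjoin_i A)"
proof -
  interpret cring A by fact
  show ?thesis
  proof (rule cringI)
    show "abelian_group (adjoin_i A)"
    proof (rule abelian_groupI)
      fix x assume "x \<in> carrier (adjoin_i A)"
      then show "\<exists>y\<in>carrier (adjoin_i A). y \<oplus>\<^bsub>adjoin_i A\<^esub> x = \<zero>\<^bsub>adjoin_i A\<^esub>"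
        by (intro bexI[of _ "(\<ominus>\<^bsub>A\<^esub> fst x, \<ominus>\<^bsub>A\<^esub> snd x)"]) (auto simp: adjoin_i_def l_neg)
    qed (auto simp: adjoin_i_def a_ac)
    show "Group.comm_monoid (adjoin_i A)"
    proof (rule comm_monoidI)
      fix x y z
      assume "x \<in> carrier (adjoin_i A)" "y \<in> carrier (adjoin_i A)" "z \<in> carrier (adjoin_i A)"
      then show "x \<otimes>\<^bsub>adjoin_i A\<^esub> y \<otimes>\<^bsub>adjoin_i A\<^esub> z = x \<otimes>\<^bsub>adjoin_i A\<^esub> (y \<otimes>\<^bsub>adjoin_i A\<^esub> z)"
        by (auto simp: adjoin_i_def a_minus_def l_distr r_distr l_minus r_minus minus_add a_ac m_ac)
    next
      fix x y
      assume "x \<in> carrier (adjoin_i A)" "y \<in> carrier (adjoin_i A)"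
      then show "x \<otimes>\<^bsub>adjoin_i A\<^esub> y = y \<otimes>\<^bsub>adjoin_i A\<^esub> x"
        by (auto simp: adjoin_i_def a_minus_def l_distr r_distr l_minus r_minus minus_add a_ac m_ac)
    qed (auto simp: adjoin_i_def a_minus_def)
  next
    fix x y z
    assume "x \<in> carrier (adjoin_i A)" "y \<in> carrier (adjoin_i A)" "z \<in> carrier (adjoin_i A)"
    then show "(x \<oplus>\<^bsub>adjoin_i A\<^esub> y) \<otimes>\<^bsub>adjoin_i A\<^esub> z =
        x \<otimes>\<^bsub>adjoin_i A\<^esub> z \<oplus>\<^bsub>adjoin_i A\<^esub> y \<otimes>\<^bsub>adjoin_i A\<^esub> z"
      by (auto simp: adjoin_i_def a_minus_def l_distr r_distr l_minus r_minus minus_add a_ac m_ac)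
  qed
qed

lemma cring_gauss_residue_ring:
  assumes "m > 1"
  shows "cring (gauss_residue_ring m)"
  unfolding gauss_residue_ring_def
  using assms by (intro cring_adjoin_i residues.cring) (simp add: residues_def)

lemma finite_gauss_residue_ring: "finite (carrier (gauss_residue_ring m))"
  by (simp add: gauss_residue_ring_def adjoin_i_def residue_ring_def)

definition nonzero_zero_divisors :: "('a, 'm) ring_scheme \<Rightarrow> 'a set"
  where "nonzero_zero_divisors R =
    {x \<in> carrier R. x \<noteq> \<zero>\<^bsub>R\<^esub> \<and> (\<exists>y \<in> carrier R. y \<noteq> \<zero>\<^bsub>R\<^esub> \<and> x \<otimes>\<^bsub>R\<^esub> y = \<zero>\<^bsub>R\<^esub>)}"

text \<open>A simple graph is a pair \<open>(V, E)\<close> whose edges are two-element subsets of \<open>V\<close>.\<close>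

definition zero_divisor_graph :: "('a, 'm) ring_scheme \<Rightarrow> 'a set \<times> 'a set set"
  where "zero_divisor_graph R =
    (nonzero_zero_divisors R,
     {{x, y} | x y. x \<in> nonzero_zero_divisors R \<and> y \<in> nonzero_zero_divisors R \<and>
        x \<noteq> y \<and> x \<otimes>\<^bsub>R\<^esub> y = \<zero>\<^bsub>R\<^esub>})"

text \<open>Only meaningful if the orders of the finite cliques are bounded, e.g. for finite graphs.\<close>

definition clique_number :: "'a set \<times> 'a set set \<Rightarrow> nat"
  where "clique_number G = Max {card C | C. C \<subseteq> fst G \<and> finite C \<and> clique C (snd G)}"

definition nilpotents_index_2 :: "('a, 'm) ring_scheme \<Rightarrow> 'a set"
  where "nilpotents_index_2 R = {x \<in> carrier R. x \<noteq> \<zero>\<^bsub>R\<^esub> \<and> x [^]\<^bsub>R\<^esub> (2::nat) = \<zero>\<^bsub>R\<^esub>}"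

end

theory Submission
  imports Defs
begin

text \<open>
  The ideal \<open>(2\<^sup>n)\<close> of \<open>\<int>[i]\<close> is a power of the prime \<open>1 + i\<close>, so vanishing in \<open>\<int>[i]/(2\<^sup>n)\<close> is read
  off the norm \<open>N(a + ib) = a\<^sup>2 + b\<^sup>2\<close>: a residue \<open>z\<close> is zero iff \<open>4\<^sup>n\<close> divides \<open>N(z)\<close>. Hence \<open>xy = 0\<close>
  iff \<open>4\<^sup>n\<close> divides \<open>N(x) N(y)\<close>, and \<open>x\<^sup>2 = 0\<close> iff \<open>2\<^sup>n\<close> divides \<open>N(x)\<close>. The nonzero elements of
  square zero thus form a clique, and \<open>xy = 0\<close> forces \<open>x\<^sup>2 = 0\<close> or \<open>y\<^sup>2 = 0\<close>, so every clique contains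
  at most one element \<open>x\<close> with \<open>x\<^sup>2 \<noteq> 0\<close>. Such an \<open>x\<close> is not adjacent to an element \<open>w\<close> of norm
  exactly \<open>2\<^sup>n\<close>, whose square is zero; exchanging \<open>x\<close> for \<open>w\<close> shows that the clique is no larger.
\<close>

lemma (in cring) nilpotents_index_2_iff:
  "x \<in> nilpotents_index_2 R \<longleftrightarrow> x \<in> carrier R \<and> x \<noteq> \<zero> \<and> x \<otimes> x = \<zero>"
  by (auto simp: nilpotents_index_2_def numeral_2_eq_2)

text \<open>Edges are unordered pairs, so commutativity is what lets either order of the product
  decide adjacency.\<close>

lemma (in cring) clique_zero_divisor_graph_iff:
  "C \<subseteq> fst (zero_divisor_graph R) \<and> clique C (snd (zero_divisor_graph R)) \<longleftrightarrow>
    C \<subseteq> nonzero_zero_divisors R \<and> (\<forall>x\<in>C. \<forall>y\<in>C. x \<noteq> y \<longrightarrow> x \<otimes> y = \<zero>)"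
proof -
  have "{x, y} \<in> snd (zero_divisor_graph R) \<longleftrightarrow> x \<otimes> y = \<zero>"
    if "x \<in> nonzero_zero_divisors R" "y \<in> nonzero_zero_divisors R" "x \<noteq> y" for x y
  proof -
    have "x \<in> carrier R" "y \<in> carrier R"
      using that by (auto simp: nonzero_zero_divisors_def)
    then have "x \<otimes> y = y \<otimes> x"
      by (rule m_comm)
    then show ?thesis
      using that by (auto simp: zero_divisor_graph_def doubleton_eq_iff)
  qed
  then show ?thesis
    unfolding clique_def by (auto simp: zero_divisor_graph_def subset_iff)
qed

text \<open>The exchange argument for an arbitrary finite commutative ring; the norm enters only
  when \<open>adj\<close>, \<open>square\<close> and \<open>w_ann\<close> are verified.\<close>

lemma (in cring) clique_number_zero_divisor_graph:
  assumes fin: "finite (carrier R)"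
    and adj: "\<And>x y. x \<in> nilpotents_index_2 R \<Longrightarrow> y \<in> nilpotents_index_2 R \<Longrightarrow> x \<otimes> y = \<zero>"
    and square: "\<And>x y. x \<in> carrier R \<Longrightarrow> y \<in> carrier R \<Longrightarrow> x \<otimes> y = \<zero> \<Longrightarrow>
      x \<otimes> x = \<zero> \<or> y \<otimes> y = \<zero>"
    and w: "w \<in> nilpotents_index_2 R"
    and w_ann: "\<And>x. x \<in> carrier R \<Longrightarrow> x \<otimes> w = \<zero> \<Longrightarrow> x \<otimes> x = \<zero>"
  shows "clique_number (zero_divisor_graph R) = card (nilpotents_index_2 R)"
proof -
  let ?N = "nilpotents_index_2 R" and ?G = "zero_divisor_graph R"
  let ?K = "{C. C \<subseteq> fst ?G \<and> finite C \<and> clique C (snd ?G)}"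
  have finN: "finite ?N"
    using fin by (auto simp: nilpotents_index_2_def)
  have "?N \<subseteq> nonzero_zero_divisors R"
    by (auto simp: nilpotents_index_2_iff nonzero_zero_divisors_def)
  then have "?N \<in> ?K"
    using clique_zero_divisor_graph_iff[of ?N] finN adj by auto
  moreover have "card C \<le> card ?N" if "C \<in> ?K" for C
  proof (cases "C \<subseteq> ?N")
    case True
    then show ?thesis
      using finN by (rule card_mono[rotated])
  next
    case False
    then obtain x where x: "x \<in> C" "x \<notin> ?N"
      by blast
    have C: "C \<subseteq> nonzero_zero_divisors R" "\<And>x y. x \<in> C \<Longrightarrow> y \<in> C \<Longrightarrow> x \<noteq> y \<Longrightarrow> x \<otimes> y = \<zero>"
      using clique_zero_divisor_graph_iff[of C] that by auto
    have Cc: "y \<in> carrier R \<and> y \<noteq> \<zero>" if "y \<in> C" for y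
      using C(1) that by (auto simp: nonzero_zero_divisors_def)
    have xx: "x \<otimes> x \<noteq> \<zero>"
      using x Cc by (auto simp: nilpotents_index_2_iff)
    \<comment> \<open>As \<open>x\<close> has nonzero square and annihilates \<open>y\<close>,
      \<open>square\<close> gives \<open>y\<close> square zero; \<open>y = w\<close> would
      contradict \<open>w_ann\<close>.\<close>
    have "C - {x} \<subseteq> ?N - {w}"
    proof
      fix y assume "y \<in> C - {x}"
      then have "x \<otimes> y = \<zero>" "y \<in> C"
        using C(2) x(1) by auto
      then show "y \<in> ?N - {w}"
        using square[of x y] w_ann[of x] xx x(1) Cc by (auto simp: nilpotents_index_2_iff)
    qed
    then have "card (C - {x}) \<le> card (?N - {w})"
      using finN by (intro card_mono) auto
    \<comment> \<open>Restoring \<open>x\<close> to \<open>C - {x}\<close> and \<open>w\<close> to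
      \<open>?N - {w}\<close> raises both cardinalities by one.\<close>
    then show ?thesis
      using that x(1) w finN by (metis (no_types, lifting) card_Suc_Diff1 Suc_le_mono mem_Collect_eq)
  qed
  moreover have "?K \<subseteq> Pow (carrier R)"
    by (auto simp: zero_divisor_graph_def nonzero_zero_divisors_def)
  then have "finite ?K"
    using fin by (simp add: finite_subset)
  ultimately have "Max (card ` ?K) = card ?N"
    by (intro Max_eqI) auto
  then show ?thesis
    by (simp add: clique_number_def setcompr_eq_image)
qed

text \<open>Descent: if both numbers are even, halving them divides the sum by 4. Otherwise the sum
  is odd or, with both odd, congruent to 2 modulo 4.\<close>

lemma four_power_dvd_sum_squares_iff:
  fixes a b :: int
  shows "4 ^ n dvd a\<^sup>2 + b\<^sup>2 \<longleftrightarrow> 2 ^ n dvd a \<and> 2 ^ n dvd b"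
proof (induction n arbitrary: a b)
  case 0
  then show ?case by simp
next
  case (Suc n)
  show ?case
  proof (cases "even a \<and> even b")
    case True
    then obtain c d where "a = 2 * c" "b = 2 * d"
      by (auto elim!: evenE)
    then have "a\<^sup>2 + b\<^sup>2 = 4 * (c\<^sup>2 + d\<^sup>2)" "a = 2 * c" "b = 2 * d"
      by (auto simp: power_mult_distrib)
    then show ?thesis
      using Suc.IH[of c d] by (simp del: distrib_left_numeral)
  next
    case False
    have "\<not> 4 dvd a\<^sup>2 + b\<^sup>2"
    proof
      assume four: "4 dvd a\<^sup>2 + b\<^sup>2"
      then have "even (a\<^sup>2 + b\<^sup>2)"
        by (rule dvd_trans[rotated]) simp
      with False have "odd a" "odd b"
        by auto
      then obtain c d where "a = 2 * c + 1" "b = 2 * d + 1"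
        by (auto elim!: oddE)
      then have "a\<^sup>2 + b\<^sup>2 = 4 * (c\<^sup>2 + c + d\<^sup>2 + d) + 2"
        by (simp add: power2_eq_square algebra_simps)
      moreover have "\<not> 4 dvd 4 * t + 2" for t :: int
        by presburger
      ultimately show False
        using four by metis
    qed
    \<comment> \<open>Both sides fail: 4 divides \<open>4 ^ Suc n\<close>, and 2 divides
      \<open>2 ^ Suc n\<close>.\<close>
    then show ?thesis
      using False by (metis dvd_mult_left power_Suc)
  qed
qed

text \<open>While both factors are even, one 2 is removed from each, using up one factor 4. Once a
  factor is odd, the other absorbs the whole remaining power of 4.\<close>

lemma two_power_dvd_or_of_four_power_dvd_mult:
  fixes r s :: int
  assumes "4 ^ n dvd r * s"
  shows "2 ^ n dvd r \<or> 2 ^ n dvd s"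
  using assms
proof (induction n arbitrary: r s)
  case 0
  then show ?case by simp
next
  case (Suc n)
  show ?case
  proof (cases "even r \<and> even s")
    case True
    then obtain r' s' where rs: "r = 2 * r'" "s = 2 * s'"
      by (auto elim!: evenE)
    with Suc.prems have "4 ^ n dvd r' * s'"
      by simp
    with Suc.IH rs show ?thesis
      by auto
  next
    case False
    then have "coprime (4 ^ Suc n) r \<or> coprime (4 ^ Suc n) s"
      using coprime_power_left_iff[of "2 :: int" "2 * Suc n"]
      by (auto simp: power_mult)
    then have "4 ^ Suc n dvd r \<or> 4 ^ Suc n dvd s"
      using Suc.prems coprime_dvd_mult_right_iff coprime_dvd_mult_left_iff by blast
    moreover have "(2 :: int) ^ Suc n dvd 4 ^ Suc n"
      by (rule dvd_power_same) simp
    ultimately show ?thesis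
      by (meson dvd_trans)
  qed
qed

text \<open>Integer-valued on representatives, since divisibility by \<open>4 ^ n\<close> is not
  visible modulo \<open>2 ^ n\<close>.\<close>

definition gauss_norm :: "int \<times> int \<Rightarrow> int"
  where "gauss_norm z = (fst z)\<^sup>2 + (snd z)\<^sup>2"

lemma exists_gauss_norm_eq_two_power:
  assumes "n > 0"
  obtains w where "w \<in> {0..<2 ^ n} \<times> {0..<2 ^ n}" "gauss_norm w = 2 ^ n"
proof -
  let ?k = "n div 2"
  \<comment> \<open>Up to a unit this is \<open>(1 + i) ^ n\<close>: \<open>2 ^ ?k\<close> for even
    \<open>n\<close>, \<open>2 ^ ?k * (1 + i)\<close> for odd \<open>n\<close>.\<close>
  define w :: "int \<times> int" where "w = (2 ^ ?k, if even n then 0 else 2 ^ ?k)"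
  have "(2 :: int) ^ ?k < 2 ^ n"
    using assms by (intro power_strict_increasing) auto
  then have "w \<in> {0..<2 ^ n} \<times> {0..<2 ^ n}"
    by (auto simp: w_def)
  moreover have "gauss_norm w = 2 ^ n"
  proof (cases "even n")
    case True
    then show ?thesis
      by (simp add: gauss_norm_def w_def flip: power_mult)
  next
    case False
    then have "n = Suc (?k * 2)"
      by presburger
    then have "(2 :: int) ^ n = 2 * 2 ^ (?k * 2)"
      by (metis power_Suc)
    then show ?thesis
      using False by (simp add: gauss_norm_def w_def flip: power_mult)
  qed
  ultimately show thesis
    using that by blast
qed

lemma carrier_gauss_residue_ring: "carrier (gauss_residue_ring m) = {0..<m} \<times> {0..<m}"
  by (auto simp: gauss_residue_ring_def adjoin_i_def residue_ring_def)

lemma zero_gauss_residue_ring: "\<zero>\<^bsub>gauss_residue_ring m\<^esub> = (0, 0)"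
  by (simp add: gauss_residue_ring_def adjoin_i_def residue_ring_def)

lemma mult_gauss_residue_ring:
  assumes "m > 1"
  shows "(a, b) \<otimes>\<^bsub>gauss_residue_ring m\<^esub> (c, d) = ((a * c - b * d) mod m, (a * d + b * c) mod m)"
proof -
  interpret residues m "residue_ring m"
    using assms by (simp_all add: residues_def)
  show ?thesis
    by (simp add: gauss_residue_ring_def adjoin_i_def a_minus_def res_add_eq res_mult_eq
        res_neg_eq mod_simps)
qed

text \<open>Both coordinates of the product are divisible by \<open>2 ^ n\<close> iff its norm is
  divisible by \<open>4 ^ n\<close>, and the norm is multiplicative.\<close>

lemma mult_gauss_residue_ring_eq_zero_iff:
  assumes "n > 0"
  shows "x \<otimes>\<^bsub>gauss_residue_ring (2 ^ n)\<^esub> y = \<zero>\<^bsub>gauss_residue_ring (2 ^ n)\<^esub> \<longleftrightarrow>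
    4 ^ n dvd gauss_norm x * gauss_norm y"
proof -
  obtain a b c d where xy: "x = (a, b)" "y = (c, d)"
    by fastforce
  have "(2 :: int) ^ n > 1"
    using assms by simp
  then have "x \<otimes>\<^bsub>gauss_residue_ring (2 ^ n)\<^esub> y = \<zero>\<^bsub>gauss_residue_ring (2 ^ n)\<^esub> \<longleftrightarrow>
      4 ^ n dvd (a * c - b * d)\<^sup>2 + (a * d + b * c)\<^sup>2"
    by (simp add: xy mult_gauss_residue_ring zero_gauss_residue_ring
        four_power_dvd_sum_squares_iff mod_eq_0_iff_dvd)
  also have "(a * c - b * d)\<^sup>2 + (a * d + b * c)\<^sup>2 = gauss_norm x * gauss_norm y"
    by (simp add: xy gauss_norm_def power2_eq_square algebra_simps)
  finally show ?thesis .
qed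

theorem lemma2p4:
  fixes n :: nat
  assumes "n > 1"
  shows "clique_number (zero_divisor_graph (gauss_residue_ring (2 ^ n))) =
    card (nilpotents_index_2 (gauss_residue_ring (2 ^ n)))"
proof -
  let ?R = "gauss_residue_ring (2 ^ n)"
  interpret cring ?R
    using assms by (intro cring_gauss_residue_ring) simp
  have n: "n > 0"
    using assms by simp
  note mult_eq_zero_iff = mult_gauss_residue_ring_eq_zero_iff[OF n]
  have four: "(4 :: int) ^ n = 2 ^ n * 2 ^ n"
    by (simp flip: power_mult_distrib)
  \<comment> \<open>The case of equal factors: \<open>4 ^ n\<close> divides the square of the norm
    iff \<open>2 ^ n\<close> divides the norm.\<close>
  have square: "x \<otimes>\<^bsub>?R\<^esub> x = \<zero>\<^bsub>?R\<^esub> \<longleftrightarrow> 2 ^ n dvd gauss_norm x" for x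
    using two_power_dvd_or_of_four_power_dvd_mult[of n "gauss_norm x" "gauss_norm x"]
    by (auto simp: mult_eq_zero_iff four mult_dvd_mono)
  obtain w where w: "w \<in> {0..<2 ^ n} \<times> {0..<2 ^ n}" "gauss_norm w = 2 ^ n"
    using exists_gauss_norm_eq_two_power[OF n] .
  show ?thesis
  proof (rule clique_number_zero_divisor_graph[where w = w])
    show "finite (carrier ?R)"
      by (rule finite_gauss_residue_ring)
    show "x \<otimes>\<^bsub>?R\<^esub> y = \<zero>\<^bsub>?R\<^esub>" if "x \<in> nilpotents_index_2 ?R" "y \<in> nilpotents_index_2 ?R" for x y
      using that by (auto simp: nilpotents_index_2_iff square mult_eq_zero_iff four mult_dvd_mono)
    show "x \<otimes>\<^bsub>?R\<^esub> x = \<zero>\<^bsub>?R\<^esub> \<or> y \<otimes>\<^bsub>?R\<^esub> y = \<zero>\<^bsub>?R\<^esub>" if "x \<otimes>\<^bsub>?R\<^esub> y = \<zero>\<^bsub>?R\<^esub>" for x y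
      using that two_power_dvd_or_of_four_power_dvd_mult by (simp add: square mult_eq_zero_iff)
    have "w \<noteq> (0, 0)"
      using w(2) by (auto simp: gauss_norm_def)
    then show "w \<in> nilpotents_index_2 ?R"
      using w square[of w]
      by (simp add: nilpotents_index_2_iff carrier_gauss_residue_ring zero_gauss_residue_ring)
    \<comment> \<open>Cancelling \<open>gauss_norm w = 2 ^ n\<close> from \<open>4 ^ n\<close>
      leaves \<open>2 ^ n dvd gauss_norm x\<close>.\<close>
    show "x \<otimes>\<^bsub>?R\<^esub> x = \<zero>\<^bsub>?R\<^esub>" if "x \<otimes>\<^bsub>?R\<^esub> w = \<zero>\<^bsub>?R\<^esub>" for x
      using that by (simp add: square mult_eq_zero_iff w(2) four)
  qed
qed

end
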